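(* The following hold. (i) For every integer $v\ge 6$ with $v\equiv 1,4,5,8\pmod{12}$ there is a simple $3-\bigl(2v,6,\tfrac{3(v-2)}{2(v-3)}\binom{v-3}{3}\bigr)$ design. (ii) For every integer $v\ge 8$ with $v\equiv 1,5,7,11,15,17\pmod{20}$ there is a simple $3-\bigl(2v,8,\tfrac{4(v-2)}{2(v-4)}\binom{v-3}{5}\bigr)$ design. (iii) For every integer $v\ge 10$ with $v\equiv 0,1,2,6\pmod 7$, $v\equiv 0,1,6,7\pmod 8$ and $\gcd(v,5)=1$ there is a simple $3-\bigl(2v,10,\tfrac{5(v-2)}{2(v-5)}\binom{v-3}{7}\bigr)$ design.
   Context: A $t-(v,k,\lambda)$ design is a pair $(X,\mathcal B)$ with $|X|=v$ and $\mathcal B$ a collection of $k$-subsets (blocks) of $X$ such that every $t$-subset of $X$ is contained in exactly $\lambda$ blocks. It is simple if it has no repeated blocks. *)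

theory Defs
  imports Complex_Main "HOL-Library.Multiset"
begin

text \<open>The blocks form a multiset, so a design may have repeated blocks; being simple is a
  separate property.\<close>

definition t_design ::
  "nat \<Rightarrow> nat \<Rightarrow> nat \<Rightarrow> nat \<Rightarrow> 'a set \<Rightarrow> 'a set multiset \<Rightarrow> bool" where
  "t_design t v k l X \<B> \<longleftrightarrow>
     finite X \<and> card X = v \<and>
     (\<forall>B \<in># \<B>. B \<subseteq> X \<and> card B = k) \<and>
     (\<forall>T. T \<subseteq> X \<and> card T = t \<longrightarrow> size {#B \<in># \<B>. T \<subseteq> B#} = l)"

definition simple_blocks :: "'a set multiset \<Rightarrow> bool" where
  "simple_blocks \<B> \<longleftrightarrow> (\<forall>B \<in># \<B>. count \<B> B = 1)"

text \<open>The index is a real number here because it is given by formulas involving a quotient.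
  The definition demands that it be a natural number. Since designs are finite, taking the
  points to be natural numbers is no restriction.\<close>

definition simple_design_exists :: "nat \<Rightarrow> nat \<Rightarrow> nat \<Rightarrow> real \<Rightarrow> bool" where
  "simple_design_exists t v k r \<longleftrightarrow>
     (\<exists>(l :: nat) (X :: nat set) \<B>.
        real l = r \<and> t_design t v k l X \<B> \<and> simple_blocks \<B>)"

end

theory Submission
  imports Defs "HOL-Library.Ramsey" "HOL-Number_Theory.Cong"
begin

text \<open>Take two disjoint copies \<open>X\<close> and \<open>Y\<close> of a \<open>v\<close>-set. Use as blocks all
  \<open>2k\<close>-subsets of \<open>X\<close>, all \<open>2k\<close>-subsets of \<open>Y\<close>, and certain crossing sets \<open>A \<union> A'\<close> with
  \<open>A\<close> a \<open>k\<close>-subset of \<open>X\<close> and \<open>A'\<close> a \<open>k\<close>-subset of \<open>Y\<close>. A triple inside one half lies in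
  both kinds of block, a triple meeting both halves only in crossing blocks, so the proportion
  of crossing sets to be used is forced: it has to balance the two degrees.

  Choosing the crossing sets regularly is a question about colourings. When \<open>k\<close> is coprime
  to \<open>v\<close>, the cyclic group of order \<open>v\<close> acts freely on the \<open>k\<close>-subsets of a \<open>v\<close>-set, since a
  translation by \<open>g\<close> changes the sum of the elements by \<open>k g\<close>. Every orbit is therefore a
  \<open>1\<close>-design with \<open>v\<close> blocks in which every point has degree \<open>k\<close>
  (\<open>regular_colouring_residues\<close>). Number the \<open>N\<close> orbits on each side and join orbit \<open>i\<close> of \<open>X\<close>
  to orbit \<open>j\<close> of \<open>Y\<close> when \<open>(i + j) mod N < d\<close>. This bipartite graph is \<open>d\<close>-regular, so the
  sets \<open>A'\<close> joined to a given \<open>A\<close> form a \<open>1\<close>-design, and symmetrically. A triple with two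
  points in \<open>X\<close> and one in \<open>Y\<close> then has the same degree wherever it lies: the pair chooses \<open>A\<close>,
  and the single point only needs a \<open>1\<close>-design (\<open>doubled_blocks_design\<close>).

  The balance condition has the solution
  \<open>d = ((v - k - 1) choose (k - 1)) / ((2k - 2) choose (k - 1))\<close>, by
  \<open>crossing_density_balance\<close>. Hence a simple \<open>3\<close>-design exists as soon as this quotient is an
  integer and \<open>k\<close> is coprime to \<open>v\<close> (\<open>simple_3_design_on_doubled_points\<close>). For
  \<open>k = 3, 4, 5\<close> the denominators are \<open>6\<close>, \<open>20\<close> and \<open>70\<close>, and the hypotheses on \<open>v\<close> yield
  these divisibilities together with the coprimality.\<close>

section \<open>Colourings of the k-subsets by regular classes\<close>

text \<open>Each colour class is a \<open>1\<close>-design with as many blocks as points. Double counting relates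
  the two cardinalities, but the class size concerns triples inside one half and the point
  degree concerns triples meeting both halves, so it is convenient to record them side by side.\<close>

definition regular_colouring :: "'a set \<Rightarrow> nat \<Rightarrow> nat \<Rightarrow> ('a set \<Rightarrow> nat) \<Rightarrow> bool" where
  "regular_colouring X k N c \<longleftrightarrow>
     (\<forall>A\<in>[X]\<^bsup>k\<^esup>. c A < N) \<and>
     (\<forall>j<N. card {A\<in>[X]\<^bsup>k\<^esup>. c A = j} = card X \<and>
             (\<forall>y\<in>X. card {A\<in>[X]\<^bsup>k\<^esup>. c A = j \<and> y \<in> A} = k))"

definition translate :: "nat \<Rightarrow> int \<Rightarrow> int set \<Rightarrow> int set" where
  "translate v g A = (\<lambda>x. (x + g) mod int v) ` A"

text \<open>Shifts range over all integers, so that the composition law below holds without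
  reduction; residues only matter when orbits are counted.\<close>

definition orbit_of :: "nat \<Rightarrow> int set \<Rightarrow> int set set" where
  "orbit_of v A = range (\<lambda>g. translate v g A)"

lemma translate_translate: "translate v g (translate v h A) = translate v (h + g) A"
  by (simp add: translate_def image_image mod_simps add.assoc)

lemma translate_mod: "translate v (g mod int v) A = translate v g A"
  by (simp add: translate_def mod_simps)

lemma translate_zero:
  assumes "A \<subseteq> {0..<int v}"
  shows "translate v 0 A = A"
  using assms by (force simp: translate_def)

lemma orbit_of_translate: "orbit_of v (translate v g A) = orbit_of v A"
proof -
  have "range (\<lambda>h. translate v (g + h) A) = (\<lambda>h. translate v h A) ` range ((+) g)"
    by (simp only: image_image)
  moreover have "range ((+) g) = UNIV" by simp
  ultimately show ?thesis by (simp only: orbit_of_def translate_translate)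
qed

lemma orbit_of_eq_iff:
  assumes "A \<subseteq> {0..<int v}"
  shows "orbit_of v A = orbit_of v B \<longleftrightarrow> A \<in> orbit_of v B"
proof
  assume "orbit_of v A = orbit_of v B"
  moreover have "A \<in> orbit_of v A"
    using translate_zero[OF assms] unfolding orbit_of_def by (metis rangeI)
  ultimately show "A \<in> orbit_of v B" by simp
next
  assume "A \<in> orbit_of v B"
  then show "orbit_of v A = orbit_of v B"
    using orbit_of_translate by (auto simp: orbit_of_def[of v B])
qed

lemma orbit_of_eq_image:
  assumes "v > 0"
  shows "orbit_of v A = (\<lambda>g. translate v g A) ` {0..<int v}"
proof -
  have "translate v g A \<in> (\<lambda>g. translate v g A) ` {0..<int v}" for g
    using assms by (intro image_eqI[where x = "g mod int v"]) (auto simp: translate_mod)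
  then show ?thesis by (auto simp: orbit_of_def)
qed

lemma inj_on_add_mod: "inj_on (\<lambda>x. (x + g) mod int v) {0..<int v}"
proof (rule inj_onI)
  fix x y assume xy: "x \<in> {0..<int v}" "y \<in> {0..<int v}" and "(x + g) mod int v = (y + g) mod int v"
  then have "[x = y] (mod int v)" by (simp add: cong_def[symmetric] cong_add_rcancel)
  with xy show "x = y" by (simp add: cong_def)
qed

lemma translate_in_nsets:
  assumes "v > 0" "A \<in> [{0..<int v}]\<^bsup>k\<^esup>"
  shows "translate v g A \<in> [{0..<int v}]\<^bsup>k\<^esup>"
  using assms card_image[OF inj_on_subset[OF inj_on_add_mod[of g v], of A]]
  by (auto simp: nsets_def translate_def)

text \<open>The sum of the elements distinguishes the translates: this is where the coprimality of
  \<open>v\<close> and \<open>k\<close> acts, through cancellation of \<open>k\<close> in \<open>inj_on_translate\<close>.\<close>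

lemma sum_translate:
  assumes "A \<in> [{0..<int v}]\<^bsup>k\<^esup>"
  shows "[\<Sum>(translate v g A) = \<Sum>A + int k * g] (mod int v)"
proof -
  have "\<Sum>(translate v g A) = (\<Sum>x\<in>A. (x + g) mod int v)"
    using assms inj_on_subset[OF inj_on_add_mod[of g v], of A]
    by (simp add: translate_def nsets_def sum.reindex)
  moreover have "[(\<Sum>x\<in>A. (x + g) mod int v) = (\<Sum>x\<in>A. x + g)] (mod int v)"
    by (intro cong_sum) (simp add: cong_def)
  ultimately show ?thesis using assms by (simp add: nsets_def sum.distrib)
qed

lemma inj_on_translate:
  assumes "coprime v k" "A \<in> [{0..<int v}]\<^bsup>k\<^esup>"
  shows "inj_on (\<lambda>g. translate v g A) {0..<int v}"
proof (rule inj_onI)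
  fix g h assume gh: "g \<in> {0..<int v}" "h \<in> {0..<int v}" and eq: "translate v g A = translate v h A"
  have "[\<Sum>A + int k * g = \<Sum>A + int k * h] (mod int v)"
    using sum_translate[OF assms(2), of g] sum_translate[OF assms(2), of h] eq
    by (metis cong_sym cong_trans)
  then have "[int k * g = int k * h] (mod int v)" by (simp add: cong_add_lcancel)
  moreover have "coprime (int k) (int v)" using assms(1) by (simp add: coprime_commute)
  ultimately have "[g = h] (mod int v)" by (simp add: cong_mult_lcancel)
  with gh show "g = h" by (simp add: cong_def)
qed

lemma mem_translate_iff:
  assumes "A \<subseteq> {0..<int v}" "y \<in> {0..<int v}"
  shows "y \<in> translate v g A \<longleftrightarrow> (y - g) mod int v \<in> A"
proof
  assume "y \<in> translate v g A"
  then obtain x where "x \<in> A" "y = (x + g) mod int v" by (auto simp: translate_def)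
  then show "(y - g) mod int v \<in> A" using assms(1) by (auto simp: mod_simps)
next
  assume "(y - g) mod int v \<in> A"
  moreover have "y = ((y - g) mod int v + g) mod int v" using assms(2) by (simp add: mod_simps)
  ultimately show "y \<in> translate v g A" unfolding translate_def by blast
qed

text \<open>For every \<open>x \<in> A\<close> exactly one shift, namely \<open>y - x\<close>, carries \<open>x\<close> to \<open>y\<close>. Different
  shifts give different translates, so nothing is counted twice.\<close>

lemma card_orbit_of_containing:
  assumes "v > 0" "coprime v k" "A \<in> [{0..<int v}]\<^bsup>k\<^esup>" "y \<in> {0..<int v}"
  shows "card {B \<in> orbit_of v A. y \<in> B} = k"
proof -
  have A: "A \<subseteq> {0..<int v}" "card A = k" using assms(3) by (auto simp: nsets_def)
  let ?G = "{g \<in> {0..<int v}. (y - g) mod int v \<in> A}"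
  have "{B \<in> orbit_of v A. y \<in> B} = (\<lambda>g. translate v g A) ` ?G"
    using mem_translate_iff[OF A(1) assms(4)] unfolding orbit_of_eq_image[OF assms(1)] by auto
  moreover have "inj_on (\<lambda>g. translate v g A) ?G"
    by (rule inj_on_subset[OF inj_on_translate[OF assms(2,3)]]) blast
  ultimately have "card {B \<in> orbit_of v A. y \<in> B} = card ?G"
    by (simp only: card_image)
  also have "\<dots> = card A"
  proof (rule bij_betw_same_card[of "\<lambda>g. (y - g) mod int v"],
         rule bij_betw_byWitness[where f' = "\<lambda>x. (y - x) mod int v"])
    have inv: "(y - (y - g) mod int v) mod int v = g" if "g \<in> {0..<int v}" for g
      using that by (simp add: mod_diff_right_eq)
    show "\<forall>g\<in>?G. (y - (y - g) mod int v) mod int v = g" using inv by blast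
    show "\<forall>x\<in>A. (y - (y - x) mod int v) mod int v = x" using inv A(1) by blast
    show "(\<lambda>x. (y - x) mod int v) ` A \<subseteq> ?G" using inv A(1) assms(1) by auto
  qed auto
  finally show ?thesis using A(2) by simp
qed

text \<open>The colours are the orbits under translation, numbered arbitrarily.\<close>

lemma regular_colouring_residues:
  assumes "v > 0" "coprime v k"
  shows "\<exists>N c. regular_colouring {0..<int v} k N c"
proof -
  let ?X = "{0..<int v}"
  define R where "R = orbit_of v ` [?X]\<^bsup>k\<^esup>"
  have "finite R" by (simp add: R_def finite_imp_finite_nsets)
  then obtain h where h: "bij_betw h R {0..<card R}" using ex_bij_betw_finite_nat by blast
  define c where "c = h \<circ> orbit_of v"
  have lt: "c A < card R" if "A \<in> [?X]\<^bsup>k\<^esup>" for A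
    using bij_betwE[OF h] that by (auto simp: c_def R_def)
  have "card {A\<in>[?X]\<^bsup>k\<^esup>. c A = j} = v \<and>
        (\<forall>y\<in>?X. card {A\<in>[?X]\<^bsup>k\<^esup>. c A = j \<and> y \<in> A} = k)" if j: "j < card R" for j
  proof -
    obtain S where S: "S \<in> [?X]\<^bsup>k\<^esup>" "j = h (orbit_of v S)"
      using h j by (force simp: R_def bij_betw_def image_iff)
    have cls: "A \<in> [?X]\<^bsup>k\<^esup> \<and> c A = j \<longleftrightarrow> A \<in> orbit_of v S" for A
    proof -
      have "A \<in> [?X]\<^bsup>k\<^esup> \<and> c A = j \<longleftrightarrow> A \<in> [?X]\<^bsup>k\<^esup> \<and> orbit_of v A = orbit_of v S"
        using inj_onD[OF bij_betw_imp_inj_on[OF h]] S by (auto simp: c_def R_def)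
      also have "\<dots> \<longleftrightarrow> A \<in> orbit_of v S"
      proof -
        have "B \<in> [?X]\<^bsup>k\<^esup>" if "B \<in> orbit_of v S" for B
          using that translate_in_nsets[OF assms(1) S(1)] unfolding orbit_of_def by blast
        moreover have "B \<subseteq> ?X" if "B \<in> [?X]\<^bsup>k\<^esup>" for B using that by (simp add: nsets_def)
        ultimately show ?thesis using orbit_of_eq_iff by metis
      qed
      finally show ?thesis .
    qed
    have "card (orbit_of v S) = v"
      unfolding orbit_of_eq_image[OF assms(1)]
      using card_image[OF inj_on_translate[OF assms(2) S(1)]] by simp
    moreover have "{A\<in>[?X]\<^bsup>k\<^esup>. c A = j} = orbit_of v S" using cls by auto
    moreover have "{A\<in>[?X]\<^bsup>k\<^esup>. c A = j \<and> y \<in> A} = {A \<in> orbit_of v S. y \<in> A}" for y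
      using cls by auto
    ultimately show ?thesis using card_orbit_of_containing[OF assms S(1)] by simp
  qed
  with lt have "regular_colouring ?X k (card R) c" by (simp add: regular_colouring_def)
  then show ?thesis by blast
qed

lemma nsets_image_inj:
  assumes "inj_on f X"
  shows "[f ` X]\<^bsup>k\<^esup> = (`) f ` [X]\<^bsup>k\<^esup>"
proof -
  have "A \<in> (`) f ` [X]\<^bsup>k\<^esup>" if A: "A \<in> [f ` X]\<^bsup>k\<^esup>" for A
  proof -
    obtain B where B: "B \<subseteq> X" "A = f ` B" using A by (auto simp: nsets_def subset_image_iff)
    then have "B \<in> [X]\<^bsup>k\<^esup>"
      using A inj_on_subset[OF assms B(1)] by (auto simp: nsets_def card_image finite_image_iff)
    with B show ?thesis by blast
  qed
  moreover have "f ` B \<in> [f ` X]\<^bsup>k\<^esup>" if "B \<in> [X]\<^bsup>k\<^esup>" for B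
    using that inj_on_subset[OF assms] by (auto simp: nsets_def card_image)
  ultimately show ?thesis by blast
qed

lemma regular_colouring_image:
  assumes "inj_on f X" "regular_colouring X k N c"
  shows "regular_colouring (f ` X) k N (\<lambda>A. c (inv_into X f ` A))"
proof -
  have inv: "inv_into X f ` f ` B = B" if "B \<in> [X]\<^bsup>k\<^esup>" for B
    using that assms(1) by (auto simp: nsets_def inv_into_image_cancel)
  have inj: "inj_on ((`) f) (Pow X)" using assms(1) by (rule inj_on_image_Pow)
  have card: "card {A\<in>[f ` X]\<^bsup>k\<^esup>. P (inv_into X f ` A)} = card {B\<in>[X]\<^bsup>k\<^esup>. P B}" for P
  proof -
    have "{A\<in>[f ` X]\<^bsup>k\<^esup>. P (inv_into X f ` A)} = (`) f ` {B\<in>[X]\<^bsup>k\<^esup>. P B}"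
      using inv by (auto simp: nsets_image_inj[OF assms(1)])
    moreover have "inj_on ((`) f) {B\<in>[X]\<^bsup>k\<^esup>. P B}"
      by (rule inj_on_subset[OF inj]) (auto simp: nsets_def)
    ultimately show ?thesis by (simp only: card_image)
  qed
  have mem: "f x \<in> A \<longleftrightarrow> x \<in> inv_into X f ` A" if "x \<in> X" "A \<in> [f ` X]\<^bsup>k\<^esup>" for x A
  proof -
    from \<open>A \<in> [f ` X]\<^bsup>k\<^esup>\<close> obtain B where B: "B \<in> [X]\<^bsup>k\<^esup>" "A = f ` B"
      by (auto simp: nsets_image_inj[OF assms(1)])
    moreover from B(1) have "f x \<in> f ` B \<longleftrightarrow> x \<in> B"
      using that(1) by (intro inj_on_image_mem_iff[OF assms(1)]) (auto simp: nsets_def)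
    ultimately show ?thesis using inv by simp
  qed
  have "card {A\<in>[f ` X]\<^bsup>k\<^esup>. c (inv_into X f ` A) = j \<and> f x \<in> A} =
        card {B\<in>[X]\<^bsup>k\<^esup>. c B = j \<and> x \<in> B}" if "x \<in> X" for x j
    using card[of "\<lambda>B. c B = j \<and> x \<in> B"] mem[OF that] by (simp cong: conj_cong)
  moreover have "c (inv_into X f ` A) < N" if "A \<in> [f ` X]\<^bsup>k\<^esup>" for A
    using that assms(2) inv by (auto simp: nsets_image_inj[OF assms(1)] regular_colouring_def)
  ultimately show ?thesis
    using assms(2) card[of "\<lambda>B. c B = j" for j] card_image[OF assms(1)]
    by (auto simp: regular_colouring_def)
qed

section \<open>Crossing blocks\<close>

lemma card_cyclic_window:
  assumes "d \<le> N"
  shows "card {j. j < N \<and> (a + j) mod N < d} = d"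
proof (cases "N = 0")
  case False
  let ?f = "\<lambda>j. (a + j) mod N"
  have inj: "inj_on ?f {..<N}"
  proof (rule inj_onI)
    fix i j assume ij: "i \<in> {..<N}" "j \<in> {..<N}" "(a + i) mod N = (a + j) mod N"
    then have "[i = j] (mod N)" by (simp add: cong_def[symmetric] cong_add_lcancel_nat)
    with ij show "i = j" by (simp add: cong_def)
  qed
  then have "?f ` {..<N} = {..<N}"
    using False by (intro endo_inj_surj) auto
  then have "{..<d} \<subseteq> ?f ` {..<N}" using assms by auto
  then have "?f ` {j. j < N \<and> ?f j < d} = {..<d}" by (force simp: subset_iff image_iff)
  then have "card (?f ` {j. j < N \<and> ?f j < d}) = d" by (simp only: card_lessThan)
  moreover have "inj_on ?f {j. j < N \<and> ?f j < d}"
    by (rule inj_on_subset[OF inj]) blast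
  ultimately show ?thesis by (simp only: card_image)
qed (use assms in simp)

text \<open>The counting principle behind the regularity of the bipartite graph of colours: a cyclic
  window of length \<open>d\<close> meets \<open>d\<close> colour classes, whatever its position. The set \<open>S\<close> will be
  all \<open>k\<close>-subsets, or those through a given point.\<close>

lemma card_colours_in_window:
  assumes "finite S" "\<And>A. A \<in> S \<Longrightarrow> c A < N" "\<And>j. j < N \<Longrightarrow> card {A\<in>S. c A = j} = m" "d \<le> N"
  shows "card {A\<in>S. (a + c A) mod N < d} = d * m"
proof -
  let ?J = "{j. j < N \<and> (a + j) mod N < d}"
  have "{A\<in>S. (a + c A) mod N < d} = (\<Union>j\<in>?J. {A\<in>S. c A = j})"
    using assms(2) by auto
  also have "card \<dots> = (\<Sum>j\<in>?J. card {A\<in>S. c A = j})"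
    using assms(1) by (intro card_UN_disjoint) auto
  also have "\<dots> = d * m" using assms(3) card_cyclic_window[OF assms(4)] by simp
  finally show ?thesis .
qed

lemma card_nsets_superset:
  assumes "finite X" "P \<subseteq> X" "card P \<le> k"
  shows "card {A\<in>[X]\<^bsup>k\<^esup>. P \<subseteq> A} = (card X - card P) choose (k - card P)"
proof -
  have fP: "finite P" using assms finite_subset by blast
  have fA: "finite A" if "A \<subseteq> X" for A using that assms finite_subset by blast
  have "bij_betw (\<lambda>A. A - P) {A\<in>[X]\<^bsup>k\<^esup>. P \<subseteq> A} {B. B \<subseteq> X - P \<and> card B = k - card P}"
  proof (rule bij_betw_byWitness[where f' = "\<lambda>B. B \<union> P"])
    show "(\<lambda>B. B \<union> P) ` {B. B \<subseteq> X - P \<and> card B = k - card P} \<subseteq> {A\<in>[X]\<^bsup>k\<^esup>. P \<subseteq> A}"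
    proof clarify
      fix B assume B: "B \<subseteq> X - P" "card B = k - card P"
      then have "card (B \<union> P) = k"
        using fA[of B] fP assms(3) by (subst card_Un_disjoint) auto
      then show "B \<union> P \<in> [X]\<^bsup>k\<^esup> \<and> P \<subseteq> B \<union> P"
        using B assms(2) fP fA[of B] by (auto simp: nsets_def)
    qed
  qed (use fP assms in \<open>auto simp: nsets_def card_Diff_subset\<close>)
  then have "card {A\<in>[X]\<^bsup>k\<^esup>. P \<subseteq> A} = card {B. B \<subseteq> X - P \<and> card B = k - card P}"
    by (rule bij_betw_same_card)
  also have "\<dots> = (card X - card P) choose (k - card P)"
    using assms fP by (simp add: n_subsets card_Diff_subset)
  finally show ?thesis .
qed

text \<open>The condition on colours depends on their sum rather than on their difference, so that
  exchanging the two halves leaves the family unchanged.\<close>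

definition crossing_blocks ::
  "'a set \<Rightarrow> 'a set \<Rightarrow> nat \<Rightarrow> nat \<Rightarrow> nat \<Rightarrow> ('a set \<Rightarrow> nat) \<Rightarrow> ('a set \<Rightarrow> nat) \<Rightarrow> 'a set set" where
  "crossing_blocks X Y k N d c c' =
     {A \<union> A' | A A'. A \<in> [X]\<^bsup>k\<^esup> \<and> A' \<in> [Y]\<^bsup>k\<^esup> \<and> (c A + c' A') mod N < d}"

lemma crossing_blocks_commute: "crossing_blocks X Y k N d c c' = crossing_blocks Y X k N d c' c"
proof -
  have "crossing_blocks X Y k N d c c' \<subseteq> crossing_blocks Y X k N d c' c" for X Y :: "'a set" and c c'
  proof
    fix B assume "B \<in> crossing_blocks X Y k N d c c'"
    then obtain A A' where "B = A' \<union> A" "A' \<in> [Y]\<^bsup>k\<^esup>" "A \<in> [X]\<^bsup>k\<^esup>" "(c' A' + c A) mod N < d"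
      by (auto simp: crossing_blocks_def Un_commute add.commute)
    then show "B \<in> crossing_blocks Y X k N d c' c" unfolding crossing_blocks_def by blast
  qed
  then show ?thesis by (intro equalityI)
qed

text \<open>A crossing block determines its two halves. The part \<open>P\<close> in \<open>X\<close> is extended freely to a
  set \<open>A\<close>; then the colour of \<open>A\<close> selects \<open>d\<close> classes on the side of \<open>Y\<close>, each containing
  \<open>m\<close> sets through \<open>Q\<close>.\<close>

lemma card_crossing_blocks_superset:
  assumes "finite X" "finite Y" "X \<inter> Y = {}" "P \<subseteq> X" "Q \<subseteq> Y" "card P \<le> k" "d \<le> N"
    and "\<And>A. A \<in> [Y]\<^bsup>k\<^esup> \<Longrightarrow> c' A < N"
    and "\<And>j. j < N \<Longrightarrow> card {A\<in>[Y]\<^bsup>k\<^esup>. c' A = j \<and> Q \<subseteq> A} = m"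
  shows "card {B \<in> crossing_blocks X Y k N d c c'. P \<union> Q \<subseteq> B} =
         ((card X - card P) choose (k - card P)) * (d * m)"
proof -
  let ?S = "{A\<in>[X]\<^bsup>k\<^esup>. P \<subseteq> A}"
  let ?L = "\<lambda>A. {A'\<in>{A'\<in>[Y]\<^bsup>k\<^esup>. Q \<subseteq> A'}. (c A + c' A') mod N < d}"
  have fin: "finite ?S" "finite {A'\<in>[Y]\<^bsup>k\<^esup>. Q \<subseteq> A'}"
    using assms(1,2) by (simp_all add: finite_imp_finite_nsets)
  have L: "card (?L A) = d * m" for A
    using assms(8,9) fin(2) assms(7)
    by (intro card_colours_in_window) (auto simp: conj_ac)
  have split: "(A \<union> A') \<inter> X = A" "(A \<union> A') \<inter> Y = A'" if "A \<in> [X]\<^bsup>k\<^esup>" "A' \<in> [Y]\<^bsup>k\<^esup>" for A A'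
    using that assms(3) by (auto simp: nsets_def)
  have sub: "P \<union> Q \<subseteq> A \<union> A' \<longleftrightarrow> P \<subseteq> A \<and> Q \<subseteq> A'" if "A \<in> [X]\<^bsup>k\<^esup>" "A' \<in> [Y]\<^bsup>k\<^esup>" for A A'
    using that assms(3-5) unfolding nsets_def by blast
  have "{B \<in> crossing_blocks X Y k N d c c'. P \<union> Q \<subseteq> B} = (\<lambda>(A, A'). A \<union> A') ` (SIGMA A:?S. ?L A)"
    (is "?B = ?U ` ?Z")
  proof
    show "?B \<subseteq> ?U ` ?Z"
    proof
      fix B assume "B \<in> ?B"
      then obtain A A' where "B = A \<union> A'" "A \<in> [X]\<^bsup>k\<^esup>" "A' \<in> [Y]\<^bsup>k\<^esup>" "(c A + c' A') mod N < d"
        "P \<union> Q \<subseteq> A \<union> A'" by (auto simp: crossing_blocks_def)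
      then have "(A, A') \<in> ?Z" "B = ?U (A, A')" using sub by auto
      then show "B \<in> ?U ` ?Z" by blast
    qed
  next
    show "?U ` ?Z \<subseteq> ?B"
    proof clarify
      fix A A' assume A: "A \<in> [X]\<^bsup>k\<^esup>" "A' \<in> [Y]\<^bsup>k\<^esup>" "(c A + c' A') mod N < d"
        and "P \<subseteq> A" "Q \<subseteq> A'"
      then have "P \<union> Q \<subseteq> A \<union> A'" by blast
      moreover have "A \<union> A' \<in> crossing_blocks X Y k N d c c'"
        using A unfolding crossing_blocks_def by blast
      ultimately show "A \<union> A' \<in> crossing_blocks X Y k N d c c' \<and> P \<union> Q \<subseteq> A \<union> A'" by blast
    qed
  qed
  moreover have "inj_on (\<lambda>(A, A'). A \<union> A') (SIGMA A:?S. ?L A)"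
  proof (rule inj_onI, clarify)
    fix A A' B B' assume "A \<in> [X]\<^bsup>k\<^esup>" "A' \<in> [Y]\<^bsup>k\<^esup>" "B \<in> [X]\<^bsup>k\<^esup>" "B' \<in> [Y]\<^bsup>k\<^esup>" "A \<union> A' = B \<union> B'"
    then show "A = B \<and> A' = B'" using split by metis
  qed
  ultimately have "card ?B = card (SIGMA A:?S. ?L A)" by (simp add: card_image)
  also have "\<dots> = card ?S * (d * m)"
    using fin L by (subst card_SigmaI) (auto intro: finite_subset[OF _ fin(2)])
  finally show ?thesis using card_nsets_superset[OF assms(1,4,6)] by simp
qed

section \<open>The design on the doubled point set\<close>

definition doubled_blocks ::
  "'a set \<Rightarrow> 'a set \<Rightarrow> nat \<Rightarrow> nat \<Rightarrow> nat \<Rightarrow> ('a set \<Rightarrow> nat) \<Rightarrow> ('a set \<Rightarrow> nat) \<Rightarrow> 'a set set" where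
  "doubled_blocks X Y k N d c c' =
     [X]\<^bsup>(2 * k)\<^esup> \<union> [Y]\<^bsup>(2 * k)\<^esup> \<union> crossing_blocks X Y k N d c c'"

lemma doubled_blocks_commute: "doubled_blocks X Y k N d c c' = doubled_blocks Y X k N d c' c"
  unfolding doubled_blocks_def crossing_blocks_commute[of X Y] by (simp only: Un_commute[of "[X]\<^bsup>(2 * k)\<^esup>"])

lemma crossing_blocks_nsets:
  assumes "X \<inter> Y = {}" "B \<in> crossing_blocks X Y k N d c c'"
  shows "B \<subseteq> X \<union> Y" "card B = 2 * k" "card (B \<inter> X) = k" "card (B \<inter> Y) = k"
proof -
  obtain A A' where A: "B = A \<union> A'" "A \<in> [X]\<^bsup>k\<^esup>" "A' \<in> [Y]\<^bsup>k\<^esup>"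
    using assms(2) by (auto simp: crossing_blocks_def)
  moreover from this have "B \<inter> X = A" "B \<inter> Y = A'" "A \<inter> A' = {}" using assms(1) by (auto simp: nsets_def)
  ultimately show "B \<subseteq> X \<union> Y" "card B = 2 * k" "card (B \<inter> X) = k" "card (B \<inter> Y) = k"
    by (auto simp: nsets_def card_Un_disjoint)
qed

text \<open>The left-hand side of \<open>bal\<close> is the degree of a triple inside \<open>X\<close>, where the crossing
  blocks contribute whole colour classes; the right-hand side is the degree of a triple with
  only one point in \<open>Y\<close>, where they contribute the sets of a class through that point.\<close>

lemma card_doubled_blocks_superset:
  assumes "finite X" "finite Y" "X \<inter> Y = {}" "card X = v" "card Y = v" "3 \<le> k"
    and "regular_colouring Y k N c'" "d \<le> N"
    and bal: "((v - 3) choose (2 * k - 3)) + ((v - 3) choose (k - 3)) * (d * v) =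
              ((v - 2) choose (k - 2)) * (d * k)"
    and T: "T \<subseteq> X \<union> Y" "card T = 3" "2 \<le> card (T \<inter> X)"
  shows "card {B \<in> doubled_blocks X Y k N d c c'. T \<subseteq> B} = ((v - 2) choose (k - 2)) * (d * k)"
proof -
  have fT: "finite T" using T(2) card.infinite by fastforce
  have TU: "T = (T \<inter> X) \<union> (T \<inter> Y)" using T(1) by auto
  have cT: "card (T \<inter> X) + card (T \<inter> Y) = 3"
    using TU T(2) assms(3) fT by (metis card_Un_disjoint finite_Int inf_commute inf_left_commute inf_bot_right)
  note lt = assms(7)[unfolded regular_colouring_def, THEN conjunct1, rule_format]
  note cls = assms(7)[unfolded regular_colouring_def, THEN conjunct2, rule_format]
  let ?C = "{B \<in> crossing_blocks X Y k N d c c'. T \<subseteq> B}"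
  have finC: "finite ?C"
  proof (rule finite_subset)
    show "?C \<subseteq> Pow (X \<union> Y)" using crossing_blocks_nsets(1)[OF assms(3)] by blast
  qed (use assms(1,2) in simp)
  have notY: "\<not> T \<subseteq> B" if "B \<subseteq> Y" for B
  proof
    assume "T \<subseteq> B"
    then have "T \<inter> X = {}" using that assms(3) by auto
    then show False using T(3) by simp
  qed
  consider "card (T \<inter> X) = 3" "card (T \<inter> Y) = 0" | "card (T \<inter> X) = 2" "card (T \<inter> Y) = 1"
    using cT T(3) by linarith
  then show ?thesis
  proof cases
    case 1
    then have TX: "T \<inter> Y = {}" "T \<subseteq> X" using fT TU by auto
    have "{B \<in> doubled_blocks X Y k N d c c'. T \<subseteq> B} = {B \<in> [X]\<^bsup>(2 * k)\<^esup>. T \<subseteq> B} \<union> ?C"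
      using notY by (auto simp: doubled_blocks_def nsets_def)
    moreover have "[X]\<^bsup>(2 * k)\<^esup> \<inter> crossing_blocks X Y k N d c c' = {}"
    proof -
      have "card (B \<inter> Y) = 0" if "B \<in> [X]\<^bsup>(2 * k)\<^esup>" for B
      proof -
        have "B \<inter> Y = {}" using that assms(3) by (auto simp: nsets_def)
        then show ?thesis by simp
      qed
      then show ?thesis using crossing_blocks_nsets(4)[OF assms(3)] assms(6) by fastforce
    qed
    moreover have "finite {B \<in> [X]\<^bsup>(2 * k)\<^esup>. T \<subseteq> B}"
      using assms(1) by (simp add: finite_imp_finite_nsets)
    ultimately have "card {B \<in> doubled_blocks X Y k N d c c'. T \<subseteq> B} =
        card {B \<in> [X]\<^bsup>(2 * k)\<^esup>. T \<subseteq> B} + card ?C"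
      using finC by (simp add: card_Un_disjoint disjoint_iff)
    moreover have "card {B \<in> [X]\<^bsup>(2 * k)\<^esup>. T \<subseteq> B} = (v - 3) choose (2 * k - 3)"
      using card_nsets_superset[OF assms(1) TX(2), of "2 * k"] T(2) assms(4,6) by simp
    moreover have "card ?C = ((v - 3) choose (k - 3)) * (d * v)"
      using card_crossing_blocks_superset[OF assms(1-3) TX(2), of "{}" k d N c' v c] T(2) assms(4-6,8) lt cls
      by simp
    ultimately show ?thesis using bal by simp
  next
    case 2
    then obtain y where y: "T \<inter> Y = {y}" using card_1_singletonE by metis
    have "\<not> T \<subseteq> B" if "B \<subseteq> X" for B using that assms(3) y by auto
    then have "{B \<in> doubled_blocks X Y k N d c c'. T \<subseteq> B} = ?C"
      using notY by (auto simp: doubled_blocks_def nsets_def)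
    moreover have "card {B \<in> crossing_blocks X Y k N d c c'. (T \<inter> X) \<union> (T \<inter> Y) \<subseteq> B} =
        ((card X - card (T \<inter> X)) choose (k - card (T \<inter> X))) * (d * k)"
    proof (rule card_crossing_blocks_superset[OF assms(1-3) _ _ _ assms(8)])
      show "card {A\<in>[Y]\<^bsup>k\<^esup>. c' A = j \<and> T \<inter> Y \<subseteq> A} = k" if "j < N" for j
        using cls[OF that] y by auto
    qed (use 2 assms(6) lt in auto)
    then have "card ?C = ((v - 2) choose (k - 2)) * (d * k)"
      using 2 assms(4) unfolding TU[symmetric] by simp
    ultimately show ?thesis by simp
  qed
qed

text \<open>Every triple has at least two points in one of the halves, and the construction is
  symmetric in the halves.\<close>

lemma doubled_blocks_design:
  assumes "finite X" "finite Y" "X \<inter> Y = {}" "card X = v" "card Y = v" "3 \<le> k"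
    and "regular_colouring X k N c" "regular_colouring Y k N c'" "d \<le> N"
    and bal: "((v - 3) choose (2 * k - 3)) + ((v - 3) choose (k - 3)) * (d * v) =
              ((v - 2) choose (k - 2)) * (d * k)"
  shows "t_design 3 (2 * v) (2 * k) (((v - 2) choose (k - 2)) * (d * k)) (X \<union> Y)
           (mset_set (doubled_blocks X Y k N d c c'))"
proof -
  let ?F = "doubled_blocks X Y k N d c c'"
  have F: "B \<subseteq> X \<union> Y \<and> card B = 2 * k" if "B \<in> ?F" for B
    using that crossing_blocks_nsets(1,2)[OF assms(3)] unfolding doubled_blocks_def nsets_def by blast
  have fin: "finite ?F"
    by (rule finite_subset[of _ "Pow (X \<union> Y)"]) (use F assms(1,2) in auto)
  have deg: "card {B \<in> ?F. T \<subseteq> B} = ((v - 2) choose (k - 2)) * (d * k)"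
    if T: "T \<subseteq> X \<union> Y" "card T = 3" for T
  proof (cases "2 \<le> card (T \<inter> X)")
    case True
    then show ?thesis using card_doubled_blocks_superset[OF assms(1-6,8,9) bal T] by blast
  next
    case False
    have "T = (T \<inter> X) \<union> (T \<inter> Y)" using T(1) by auto
    then have "3 \<le> card (T \<inter> X) + card (T \<inter> Y)" using T(2) card_Un_le by metis
    then have "2 \<le> card (T \<inter> Y)" using False by simp
    moreover have "Y \<inter> X = {}" "T \<subseteq> Y \<union> X" using assms(3) T(1) by auto
    ultimately show ?thesis
      using card_doubled_blocks_superset[OF assms(2,1) _ assms(5,4,6,7,9) bal _ T(2)]
      by (simp add: doubled_blocks_commute[of X])
  qed
  show ?thesis
    unfolding t_design_def
    using assms(1-5) F fin deg by (simp add: card_Un_disjoint filter_mset_mset_set)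
qed

lemma regular_colouring_num_colours:
  assumes "finite X" "regular_colouring X k N c"
  shows "N * card X = card X choose k"
proof -
  have fin: "finite ([X]\<^bsup>k\<^esup>)" using assms(1) by (rule finite_imp_finite_nsets)
  have "card {A\<in>[X]\<^bsup>k\<^esup>. (0 + c A) mod N < N} = N * card X"
    using assms fin by (intro card_colours_in_window) (auto simp: regular_colouring_def)
  moreover have "{A\<in>[X]\<^bsup>k\<^esup>. (0 + c A) mod N < N} = [X]\<^bsup>k\<^esup>"
    using assms(2) by (auto simp: regular_colouring_def)
  moreover have "[X]\<^bsup>k\<^esup> = {A. A \<subseteq> X \<and> card A = k}"
    using assms(1) finite_subset by (auto simp: nsets_def)
  ultimately show ?thesis using n_subsets[OF assms(1), of k] by simp
qed

section \<open>The number of colour classes to join\<close>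

text \<open>The balance condition of the construction, multiplied by \<open>k - 2\<close> and freed of the
  binomials with upper index \<open>v - 2\<close>. It follows by comparing two ways of choosing nested
  subsets of sizes \<open>k - 3\<close> and \<open>2k - 3\<close> in a set with \<open>v - 3\<close> elements, and by writing the
  central binomial coefficient as \<open>2 * ((2k - 3) choose (k - 1))\<close>.\<close>

lemma crossing_density_balance:
  fixes v k d :: nat
  assumes "3 \<le> k" "2 * k \<le> v" and d: "d * ((2 * k - 2) choose (k - 1)) = (v - k - 1) choose (k - 1)"
  shows "(k - 2) * ((v - 3) choose (2 * k - 3)) = 2 * (v - k) * d * ((v - 3) choose (k - 3))"
proof -
  let ?a = "(2 * k - 3) choose (k - 1)" and ?b = "(2 * k - 3) choose k"
  have sym: "(2 * k - 3) choose (k - 3) = ?b" "(2 * k - 3) choose (k - 2) = ?a"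
    using assms(1) binomial_symmetric[of k "2 * k - 3"] binomial_symmetric[of "k - 1" "2 * k - 3"]
    by (simp_all add: numeral_eq_Suc)
  have ab: "k * ?b = (k - 2) * ?a"
  proof -
    have "2 * k - 3 - (k - 1) = k - 2" using assms(1) by simp
    then show ?thesis
      using assms(1) binomial_absorb_comp[of "2 * k - 3" "k - 1"] times_binomial_minus1_eq[of k "2 * k - 3"]
      by simp
  qed
  have central: "(2 * k - 2) choose (k - 1) = 2 * ?a"
    using choose_reduce_nat[of "2 * k - 2" "k - 1"] sym assms(1)
    by (simp add: numeral_eq_Suc)
  have up: "k * ((v - k) choose k) = (v - k) * ((v - k - 1) choose (k - 1))"
    using assms(1) by (simp add: times_binomial_minus1_eq)
  have mult: "((v - 3) choose (2 * k - 3)) * ?b = ((v - 3) choose (k - 3)) * ((v - k) choose k)"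
  proof -
    have e: "v - 3 - (k - 3) = v - k" "2 * k - 3 - (k - 3) = k" using assms by auto
    show ?thesis using choose_mult[of "k - 3" "2 * k - 3" "v - 3"] assms unfolding sym(1) e by simp
  qed
  have "?a * ((k - 2) * ((v - 3) choose (2 * k - 3))) = k * (((v - 3) choose (2 * k - 3)) * ?b)"
    using ab by (simp add: ac_simps)
  also have "\<dots> = ((v - 3) choose (k - 3)) * ((v - k) * (d * (2 * ?a)))"
    unfolding mult using up d central by (simp add: ac_simps)
  finally have "?a * ((k - 2) * ((v - 3) choose (2 * k - 3))) =
                ?a * (2 * (v - k) * d * ((v - 3) choose (k - 3)))" by (simp add: ac_simps)
  moreover have "?a > 0" using assms(1) by simp
  ultimately show ?thesis by simp
qed


text \<open>The index is the degree \<open>((v - 2) choose (k - 2)) * d * k\<close> of a triple meeting both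
  halves, rewritten by means of \<open>crossing_density_balance\<close>.\<close>

theorem simple_3_design_on_doubled_points:
  assumes "3 \<le> k" "2 * k \<le> v" "coprime v k"
    and dvd: "((2 * k - 2) choose (k - 1)) dvd ((v - k - 1) choose (k - 1))"
  shows "simple_design_exists 3 (2 * v) (2 * k)
           (real k * (real v - 2) / (2 * (real v - real k)) * real ((v - 3) choose (2 * k - 3)))"
proof -
  obtain d where d: "d * ((2 * k - 2) choose (k - 1)) = (v - k - 1) choose (k - 1)"
    using dvd by (metis dvd_div_mult_self)
  let ?C = "(v - 3) choose (k - 3)" and ?P = "(v - 2) choose (k - 2)" and ?Q = "(v - 3) choose (2 * k - 3)"
  have Q: "(k - 2) * ?Q = 2 * (v - k) * d * ?C"
    using crossing_density_balance[OF assms(1,2) d] .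
  have P: "(k - 2) * ?P = (v - 2) * ?C"
    using assms(1) times_binomial_minus1_eq[of "k - 2" "v - 2"] by (simp add: numeral_eq_Suc)
  have bal: "?Q + ?C * (d * v) = ?P * (d * k)"
  proof -
    have "2 * (v - k) + v * (k - 2) = k * (v - 2)"
      using assms(1,2) by (simp add: nat_eq_iff algebra_simps diff_mult_distrib2)
    then have "(k - 2) * (?Q + ?C * (d * v)) = (k - 2) * (?P * (d * k))"
      using P Q by algebra
    then show ?thesis using assms(1) by simp
  qed
  let ?r = "real k * (real v - 2) / (2 * (real v - real k)) * real ?Q"
  have index: "real (?P * (d * k)) = ?r"
  proof -
    have Q': "(real k - 2) * real ?Q = 2 * (real v - real k) * real d * real ?C"
      and P': "(real k - 2) * real ?P = (real v - 2) * real ?C"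
      using arg_cong[OF Q, of real] arg_cong[OF P, of real] assms(1,2) by (simp_all add: of_nat_diff)
    have nz: "real k - 2 \<noteq> 0" "real v - real k \<noteq> 0" using assms(1,2) by auto
    have "(real k - 2) * ?r = real k * (real v - 2) / (2 * (real v - real k)) * ((real k - 2) * real ?Q)"
      by simp
    also have "\<dots> = real d * real k * ((real v - 2) * real ?C)"
      unfolding Q' using nz(2) by (simp add: field_simps)
    also have "\<dots> = (real k - 2) * real (?P * (d * k))"
      unfolding P'[symmetric] by simp
    finally show ?thesis using mult_left_cancel[OF nz(1)] by metis
  qed
  have "v > 0" using assms(1,2) by simp
  then obtain N c where c: "regular_colouring {0..<int v} k N c"
    using regular_colouring_residues assms(3) by blast
  \<comment> \<open>There are enough colours: \<open>N\<close> is \<open>((v - 1) choose (k - 1)) / k\<close>, and the central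
    binomial coefficient in the denominator of \<open>d\<close> is at least \<open>k\<close>.\<close>
  have dN: "d \<le> N"
  proof -
    have "(2 * k - 2) choose (k - 1) \<ge> k"
    proof -
      have "k choose (k - 1) \<le> (2 * k - 2) choose (k - 1)"
        using assms(1) by (intro binomial_right_mono) simp
      then show ?thesis using binomial_symmetric[of 1 k] assms(1) by simp
    qed
    then have "k * d \<le> (v - k - 1) choose (k - 1)" using d by (metis mult.commute mult_le_mono1)
    also have "\<dots> \<le> (v - 1) choose (k - 1)" by (rule binomial_right_mono) simp
    finally have "v * (k * d) \<le> v * ((v - 1) choose (k - 1))" by simp
    also have "\<dots> = k * (N * v)"
      using regular_colouring_num_colours[OF _ c] times_binomial_minus1_eq[of k v] assms(1) by simp
    finally show ?thesis using assms(1,2) by (simp add: ac_simps)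
  qed
  let ?X = "nat ` {0..<int v}" and ?Y = "(\<lambda>x. v + nat x) ` {0..<int v}"
  have inj: "inj_on nat {0..<int v}" "inj_on (\<lambda>x. v + nat x) {0..<int v}"
    by (auto simp: inj_on_def)
  obtain c1 c2 where "regular_colouring ?X k N c1" "regular_colouring ?Y k N c2"
    using regular_colouring_image[OF _ c] inj by blast
  moreover have "?X \<inter> ?Y = {}" by auto
  ultimately have "t_design 3 (2 * v) (2 * k) (?P * (d * k)) (?X \<union> ?Y)
           (mset_set (doubled_blocks ?X ?Y k N d c1 c2))"
    using assms(1) dN bal inj by (intro doubled_blocks_design) (auto simp: card_image)
  moreover have "simple_blocks (mset_set F)" for F :: "nat set set"
    by (cases "finite F") (auto simp: simple_blocks_def)
  ultimately show ?thesis unfolding simple_design_exists_def using index by blast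
qed

section \<open>Divisibility for block sizes 6, 8 and 10\<close>

lemma choose_2_mult: "2 * (n choose 2) = n * (n - 1)" for n :: nat
  using times_binomial_minus1_eq[of 2 n] by simp

lemma choose_3_mult: "6 * (n choose 3) = n * (n - 1) * (n - 2)" for n :: nat
proof -
  have "3 * (n choose 3) = n * ((n - 1) choose 2)" using times_binomial_minus1_eq[of 3 n] by simp
  moreover have "2 * ((n - 1) choose 2) = (n - 1) * (n - 2)"
  proof -
    have "n - 1 - 1 = n - 2" by arith
    then show ?thesis using choose_2_mult[of "n - 1"] by simp
  qed
  ultimately show ?thesis by algebra
qed

lemma choose_4_mult: "24 * (n choose 4) = n * (n - 1) * (n - 2) * (n - 3)" for n :: nat
proof -
  have "4 * (n choose 4) = n * ((n - 1) choose 3)" using times_binomial_minus1_eq[of 4 n] by simp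
  moreover have "6 * ((n - 1) choose 3) = (n - 1) * (n - 2) * (n - 3)"
  proof -
    have "n - 1 - 1 = n - 2" "n - 1 - 2 = n - 3" by arith+
    then show ?thesis using choose_3_mult[of "n - 1"] by simp
  qed
  ultimately show ?thesis by algebra
qed

lemma coprime_factor_dvd:
  fixes m c :: nat
  assumes "m dvd a * c" "coprime m a"
  shows "m dvd c"
  using assms by (simp add: coprime_dvd_mult_right_iff)

lemma dvd_diff_of_mod: "m dvd n - i" if "n mod m = i" for m n i :: nat
  using that dvd_minus_mod by metis

lemma six_dvd_choose_2:
  fixes n :: nat
  assumes "n mod 4 \<in> {0, 1}" "n mod 3 \<in> {0, 1}"
  shows "6 dvd n choose 2"
proof -
  have "4 dvd n \<or> 4 dvd n - 1" "3 dvd n \<or> 3 dvd n - 1"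
    using assms dvd_diff_of_mod[of n 4 1] dvd_diff_of_mod[of n 3 1] by auto
  then have "4 dvd n * (n - 1)" "3 dvd n * (n - 1)" by auto
  then have four: "2 * 2 dvd 2 * (n choose 2)" and three: "3 dvd 2 * (n choose 2)"
    unfolding choose_2_mult by simp_all
  have "2 dvd n choose 2" using four by simp
  moreover have "3 dvd n choose 2" using coprime_factor_dvd[OF three] by simp
  ultimately have "2 * 3 dvd n choose 2" by (intro divides_mult) simp_all
  then show ?thesis by simp
qed

text \<open>For even \<open>n\<close> the factors \<open>n\<close> and \<open>n - 2\<close> are twice two consecutive integers, so \<open>8\<close>
  divides their product; the factor \<open>6\<close> in front of the binomial coefficient absorbs one \<open>2\<close>.\<close>

lemma twenty_dvd_choose_3:
  fixes n :: nat
  assumes "even n" "n mod 5 \<in> {0, 1, 2}"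
  shows "20 dvd n choose 3"
proof -
  obtain m where m: "n = 2 * m" using assms(1) by blast
  have "2 dvd m * (m - 1)" by (cases "even m") auto
  then have "4 * 2 dvd 4 * (m * (m - 1))" by (rule mult_dvd_mono[OF dvd_refl])
  also have "4 * (m * (m - 1)) = n * (n - 2)" unfolding m by (simp add: diff_mult_distrib2)
  also have "\<dots> dvd n * (n - 1) * (n - 2)" by simp
  finally have "2 * 4 dvd 2 * (3 * (n choose 3))" using choose_3_mult[of n] by simp
  then have four: "4 dvd 3 * (n choose 3)" by simp
  have "5 dvd n \<or> 5 dvd n - 1 \<or> 5 dvd n - 2"
    using assms(2) dvd_diff_of_mod[of n 5 1] dvd_diff_of_mod[of n 5 2] by auto
  then have five: "5 dvd 6 * (n choose 3)" unfolding choose_3_mult by auto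
  have "coprime 4 (3::nat)" "coprime 5 (6::nat)" "coprime 4 (5::nat)"
    by (simp_all add: coprime_iff_gcd_eq_1 gcd_non_0_nat)
  then have "4 * 5 dvd n choose 3"
    using coprime_factor_dvd[OF four] coprime_factor_dvd[OF five] by (intro divides_mult)
  then show ?thesis by simp
qed

text \<open>One of \<open>n, ..., n - 3\<close> is a multiple of \<open>8\<close>, and a second one is even, so \<open>16\<close> divides
  their product; the factor \<open>24\<close> in front of the binomial coefficient absorbs \<open>8\<close>.\<close>

lemma seventy_dvd_choose_4:
  fixes n :: nat
  assumes "n mod 8 \<in> {0, 1, 2, 3}" "n mod 5 \<in> {0, 1, 2, 3}" "n mod 7 \<in> {0, 1, 2, 3}"
  shows "70 dvd n choose 4"
proof -
  have "8 dvd n \<and> 2 dvd n - 2 \<or> 2 dvd n \<and> 8 dvd n - 2 \<or>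
        8 dvd n - 1 \<and> 2 dvd n - 3 \<or> 2 dvd n - 1 \<and> 8 dvd n - 3"
  proof -
    consider "n mod 8 = 0" | "n mod 8 = 1" | "n mod 8 = 2" | "n mod 8 = 3" using assms(1) by auto
    then show ?thesis
    proof cases
      case 1
      then have "8 dvd n" "2 dvd n - 2" by presburger+
      then show ?thesis by blast
    next
      case 2
      then have "8 dvd n - 1" "2 dvd n - 3" by presburger+
      then show ?thesis by blast
    next
      case 3
      then have "2 dvd n" "8 dvd n - 2" by presburger+
      then show ?thesis by blast
    next
      case 4
      then have "2 dvd n - 1" "8 dvd n - 3" by presburger+
      then show ?thesis by blast
    qed
  qed
  then have "8 * 2 dvd n * (n - 2) \<or> 2 * 8 dvd n * (n - 2) \<or>
        8 * 2 dvd (n - 1) * (n - 3) \<or> 2 * 8 dvd (n - 1) * (n - 3)"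
    using mult_dvd_mono by blast
  then have "8 * 2 dvd n * (n - 2) \<or> 8 * 2 dvd (n - 1) * (n - 3)" by auto
  then have "8 * 2 dvd (n * (n - 2)) * ((n - 1) * (n - 3))" using dvd_mult dvd_mult2 by blast
  also have "\<dots> = 8 * (3 * (n choose 4))" using choose_4_mult[of n] by (simp add: ac_simps)
  finally have two: "2 dvd 3 * (n choose 4)" by simp
  have falling: "m dvd 24 * (n choose 4)" if "n mod m \<in> {0, 1, 2, 3}" for m
  proof -
    have "m dvd n \<or> m dvd n - 1 \<or> m dvd n - 2 \<or> m dvd n - 3"
      using that dvd_diff_of_mod[of n m 1] dvd_diff_of_mod[of n m 2] dvd_diff_of_mod[of n m 3] by auto
    then show ?thesis unfolding choose_4_mult by auto
  qed
  note five = falling[OF assms(2)] and seven = falling[OF assms(3)]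
  have cop: "coprime 2 (3::nat)" "coprime 5 (24::nat)" "coprime 7 (24::nat)"
    "coprime 2 (5::nat)" "coprime (2 * 5) (7::nat)"
    by (simp_all add: coprime_iff_gcd_eq_1 gcd_non_0_nat)
  have "2 dvd n choose 4" "5 dvd n choose 4" "7 dvd n choose 4"
    using coprime_factor_dvd[OF two] coprime_factor_dvd[OF five] coprime_factor_dvd[OF seven] cop
    by blast+
  then have "2 * 5 * 7 dvd n choose 4" using cop(4,5) by (intro divides_mult)
  then show ?thesis by simp
qed

lemma residues_mod_12:
  fixes v :: nat
  assumes v: "v \<ge> 6" "v mod 12 \<in> {1, 4, 5, 8}"
  shows "coprime v 3" "(v - 4) mod 4 \<in> {0, 1}" "(v - 4) mod 3 \<in> {0, 1}"
proof -
  have r: "v mod 4 \<in> {0, 1}" "v mod 3 \<in> {1, 2}"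
    using v(2) mod_mod_cancel[of 4 12 v] mod_mod_cancel[of 3 12 v] by auto
  show "coprime v 3" using r(2) prime_imp_coprime[of 3 v] by (auto simp: coprime_commute dvd_eq_mod_eq_0)
  define n where "n = v - 4"
  then have n: "v = n + 4" using v(1) by simp
  show "(v - 4) mod 4 \<in> {0, 1}" using r(1) by (simp add: n)
  have "n mod 3 = 0 \<or> n mod 3 = 1" using r(2) unfolding n insert_iff empty_iff by presburger
  then show "(v - 4) mod 3 \<in> {0, 1}" by (simp add: n)
qed

lemma residues_mod_20:
  fixes v :: nat
  assumes v: "v \<ge> 8" "v mod 20 \<in> {1, 5, 7, 11, 15, 17}"
  shows "odd v" "even (v - 5)" "(v - 5) mod 5 \<in> {0, 1, 2}"
proof -
  have r: "v mod 2 = v mod 20 mod 2" "v mod 5 = v mod 20 mod 5" by (simp_all add: mod_mod_cancel)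
  show "odd v" using r(1) v(2) by (auto simp: odd_iff_mod_2_eq_one)
  then show "even (v - 5)" by simp
  have "(v - 5) mod 5 = v mod 5" using v(1) by (simp add: le_mod_geq)
  then show "(v - 5) mod 5 \<in> {0, 1, 2}" using r(2) v(2) by auto
qed

lemma residues_mod_5_7_8:
  fixes v :: nat
  assumes v: "v \<ge> 10" "v mod 7 \<in> {0, 1, 2, 6}" "v mod 8 \<in> {0, 1, 6, 7}" "gcd v 5 = 1"
  shows "(v - 6) mod 8 \<in> {0, 1, 2, 3}" "(v - 6) mod 5 \<in> {0, 1, 2, 3}" "(v - 6) mod 7 \<in> {0, 1, 2, 3}"
proof -
  define n where "n = v - 6"
  then have n: "v = n + 6" using v(1) by simp
  have 5: "v mod 5 \<noteq> 0" using v(4) by (auto simp: gcd_nat.absorb2 dvd_eq_mod_eq_0[symmetric])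
  \<comment> \<open>The residue of \<open>n\<close> takes few values, and is found from that of \<open>n + 6\<close> by inspection.\<close>
  have shift: "(n mod m + 6) mod m = v mod m" for m by (simp add: n mod_simps)
  show "(v - 6) mod 8 \<in> {0, 1, 2, 3}"
  proof -
    have "a \<in> {0, 1, 2, 3}" if "a < 8" "(a + 6) mod 8 \<in> {0, 1, 6, 7}" for a :: nat
    proof -
      have "a = 0 \<or> a = 1 \<or> a = 2 \<or> a = 3 \<or> a = 4 \<or> a = 5 \<or> a = 6 \<or> a = 7" using that(1) by linarith
      then show ?thesis using that(2) by (elim disjE) simp_all
    qed
    from this[of "n mod 8"] show ?thesis unfolding shift n_def[symmetric] using v(3) by simp
  qed
  show "(v - 6) mod 5 \<in> {0, 1, 2, 3}"
  proof -
    have "a \<in> {0, 1, 2, 3}" if "a < 5" "(a + 6) mod 5 \<noteq> 0" for a :: nat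
    proof -
      have "a = 0 \<or> a = 1 \<or> a = 2 \<or> a = 3 \<or> a = 4" using that(1) by linarith
      then show ?thesis using that(2) by (elim disjE) simp_all
    qed
    from this[of "n mod 5"] show ?thesis unfolding shift n_def[symmetric] using 5 by simp
  qed
  show "(v - 6) mod 7 \<in> {0, 1, 2, 3}"
  proof -
    have "a \<in> {0, 1, 2, 3}" if "a < 7" "(a + 6) mod 7 \<in> {0, 1, 2, 6}" for a :: nat
    proof -
      have "a = 0 \<or> a = 1 \<or> a = 2 \<or> a = 3 \<or> a = 4 \<or> a = 5 \<or> a = 6" using that(1) by linarith
      then show ?thesis using that(2) by (elim disjE) simp_all
    qed
    from this[of "n mod 7"] show ?thesis unfolding shift n_def[symmetric] using v(2) by simp
  qed
qed

theorem corollary3p6: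
  shows "(\<forall>v::nat. v \<ge> 6 \<and> v mod 12 \<in> {1, 4, 5, 8} \<longrightarrow>
            simple_design_exists 3 (2 * v) 6
              (3 * (real v - 2) / (2 * (real v - 3)) * real ((v - 3) choose 3)))
       \<and> (\<forall>v::nat. v \<ge> 8 \<and> v mod 20 \<in> {1, 5, 7, 11, 15, 17} \<longrightarrow>
            simple_design_exists 3 (2 * v) 8
              (4 * (real v - 2) / (2 * (real v - 4)) * real ((v - 3) choose 5)))
       \<and> (\<forall>v::nat. v \<ge> 10 \<and> v mod 7 \<in> {0, 1, 2, 6} \<and> v mod 8 \<in> {0, 1, 6, 7} \<and> gcd v 5 = 1 \<longrightarrow>
            simple_design_exists 3 (2 * v) 10
              (5 * (real v - 2) / (2 * (real v - 5)) * real ((v - 3) choose 7)))"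
proof (intro conjI allI impI; elim conjE)
  fix v :: nat assume v: "v \<ge> 6" "v mod 12 \<in> {1, 4, 5, 8}"
  have "(4 choose 2) = (6::nat)" by (simp add: numeral_eq_Suc)
  then show "simple_design_exists 3 (2 * v) 6
      (3 * (real v - 2) / (2 * (real v - 3)) * real ((v - 3) choose 3))"
    using simple_3_design_on_doubled_points[of 3 v] residues_mod_12[OF v] six_dvd_choose_2[of "v - 4"]
      v(1)
    by simp
next
  fix v :: nat assume v: "v \<ge> 8" "v mod 20 \<in> {1, 5, 7, 11, 15, 17}"
  note r = residues_mod_20[OF v]
  have "coprime v 4"
    using r(1) coprime_power_right_iff[of v 2 2] by simp
  moreover have "(6 choose 3) = (20::nat)" by (simp add: numeral_eq_Suc)
  ultimately show "simple_design_exists 3 (2 * v) 8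
      (4 * (real v - 2) / (2 * (real v - 4)) * real ((v - 3) choose 5))"
    using simple_3_design_on_doubled_points[of 4 v] twenty_dvd_choose_3[OF r(2,3)] v(1) by simp
next
  fix v :: nat
  assume v: "v \<ge> 10" "v mod 7 \<in> {0, 1, 2, 6}" "v mod 8 \<in> {0, 1, 6, 7}" "gcd v 5 = 1"
  have "coprime v 5" using v(4) by (simp add: coprime_iff_gcd_eq_1)
  moreover have "(8 choose 4) = (70::nat)" by (simp add: numeral_eq_Suc)
  ultimately show "simple_design_exists 3 (2 * v) 10
      (5 * (real v - 2) / (2 * (real v - 5)) * real ((v - 3) choose 7))"
    using simple_3_design_on_doubled_points[of 5 v] seventy_dvd_choose_4[OF residues_mod_5_7_8[OF v]] v(1)
    by simp
qed

end
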